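(* Let $A\in\mathbb{R}^{M\times N}$, $b\in\mathbb{R}^M$, $r(x)=\frac12\|Ax-b\|^2$, $S=\{x\in\mathbb{R}^N : \|x\|_0\le s\}$, and consider the problem $\min r(x)$ subject to $x\in S\cap\mathbb{R}^N_+$. Let $\alpha>0$. A) If $\|x^*\|_0=s$ and $x^*\ge0$, then: $x^*$ is an $\alpha$-stationary point $\Longrightarrow$ $x^*$ is an $N^B$-stationary point $\Longleftrightarrow$ $x^*$ is a $T^B$-stationary point. B) If $\|x^*\|_0\le s$ and $x^*\ge0$, then: $x^*$ is an $\alpha$-stationary point $\Longrightarrow$ $x^*$ is an $N^C$-stationary point $\Longleftrightarrow$ $x^*$ is a $T^C$-stationary point.
   Context: $s<M<N$ are positive integers; $\|x\|_0$ is the number of nonzero entries of $x$; $\|\cdot\|$ is the Euclidean norm; $x\ge0$ is componentwise. Put $\Omega=S\cap\mathbb{R}^N_+$ and let $P_\Omega(x)=\arg\min_{y\in\Omega}\|x-y\|$ be the (set-valued) projection. For $\overline{x}\in\Omega$, the Bouligand tangent cone is $$T^B_\Omega(\overline{x})=\Big\{d\in\mathbb{R}^N : \exists \{x^k\}\subset\Omega,\ \lim_{k\to\infty}x^k=\overline{x},\ \lambda_k\ge0\ (k=1,2,\dots),\ \text{such that } \lim_{k\to\infty}\lambda_k(x^k-\overline{x})=d\Big\};$$ the Clarke tangent cone $T^C_\Omega(\overline{x})$ is the set of all $d\in\mathbb{R}^N$ such that for every sequence $\{x^k\}\subset\Omega$ with $\lim_{k\to\infty}x^k=\overline{x}$ and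 every sequence $\{\lambda_k\}\subset\mathbb{R}_+$ with $\lim_{k\to\infty}\lambda_k=0$ there exists a sequence $\{y^k\}\subset\mathbb{R}^N$ with $\lim_{k\to\infty}y^k=d$ and $x^k+\lambda_k y^k\in\Omega$ for $k=1,2,\dots$. For $\sharp\in\{B,C\}$, $N^\sharp_\Omega(\overline{x})=\{d\in\mathbb{R}^N : \langle d,z\rangle\le0\ \ \forall z\in T^\sharp_\Omega(\overline{x})\}$. A point $x^*\in\Omega$ is called: - an $\alpha$-stationary point if $x^*\in P_\Omega(x^*-\alpha\nabla r(x^* ))$; - an $N^\sharp$-stationary point if $0\in\nabla r(x^* )+N^\sharp_\Omega(x^* )$; - a $T^\sharp$-stationary point if $\|\nabla^\sharp_\Omega r(x^* )\|=0$, where $\nabla^\sharp_\Omega r(x^* )=\arg\min\{\|d+\nabla r(x^* )\| : d\in T^\sharp_\Omega(x^* )\}$. *)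

theory Defs
  imports "HOL-Analysis.Analysis"
begin

definition l0 :: "real ^ 'n \<Rightarrow> nat"
  where "l0 x = card {i. x $ i \<noteq> 0}"

definition sparse_set :: "nat \<Rightarrow> (real ^ 'n) set"
  where "sparse_set s = {x. l0 x \<le> s}"

text \<open>The order on \<^typ>\<open>real ^ 'n\<close> is componentwise.\<close>

definition nonneg_sparse :: "nat \<Rightarrow> (real ^ 'n) set"
  where "nonneg_sparse s = sparse_set s \<inter> {x. 0 \<le> x}"

definition residual :: "real ^ 'n ^ 'm \<Rightarrow> real ^ 'm \<Rightarrow> real ^ 'n \<Rightarrow> real"
  where "residual A b x = 1 / 2 * (norm (A *v x - b))\<^sup>2"

definition grad :: "('a::real_inner \<Rightarrow> real) \<Rightarrow> 'a \<Rightarrow> 'a"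
  where "grad f x = (THE g. GDERIV f x :> g)"

lemma grad_eqI:
  assumes "GDERIV f x :> g"
  shows "grad f x = g"
  unfolding grad_def
proof (rule the_equality)
  fix h assume "GDERIV f x :> h"
  then have "(\<lambda>v. v \<bullet> h) = (\<lambda>v. v \<bullet> g)"
    using assms unfolding gderiv_def by (rule has_derivative_unique)
  then have "\<forall>v. v \<bullet> h = v \<bullet> g"
    by (rule fun_cong[THEN allI])
  then show "h = g"
    by (simp only: vector_eq_ldot)
qed (fact assms)

lemma grad_residual: "grad (residual A b) x = transpose A *v (A *v x - b)"
proof (rule grad_eqI)
  have 1: "((\<lambda>x. A *v x - b) has_derivative (\<lambda>v. A *v v)) (at x)"
    by (rule has_derivative_eq_rhs,
        rule has_derivative_diff[OF
          bounded_linear_imp_has_derivative[OF matrix_vector_mul_bounded_linear]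
          has_derivative_const]) simp
  have "((\<lambda>x. 1 / 2 * ((A *v x - b) \<bullet> (A *v x - b))) has_derivative
      (\<lambda>v. 1 / 2 * ((A *v x - b) \<bullet> (A *v v) + (A *v v) \<bullet> (A *v x - b)))) (at x)"
    by (rule has_derivative_mult_right, rule has_derivative_inner[OF 1 1])
  moreover have "1 / 2 * ((A *v x - b) \<bullet> (A *v v) + (A *v v) \<bullet> (A *v x - b))
      = v \<bullet> (transpose A *v (A *v x - b))" for v
  proof -
    have "(A *v x - b) \<bullet> (A *v v) = v \<bullet> (transpose A *v (A *v x - b))"
      by (metis dot_lmul_matrix inner_commute transpose_matrix_vector)
    then show ?thesis by (simp add: inner_commute[of "A *v v"])
  qed
  ultimately show "GDERIV (residual A b) x :> transpose A *v (A *v x - b)"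
    by (simp only: gderiv_def residual_def[abs_def] power2_norm_eq_inner)
qed

text \<open>Set-valued: there may be several nearest points, or none.\<close>

definition proj :: "'a::real_normed_vector set \<Rightarrow> 'a \<Rightarrow> 'a set"
  where "proj \<Omega> x = {y. is_arg_min (\<lambda>y. norm (x - y)) (\<lambda>y. y \<in> \<Omega>) y}"

definition bouligand_cone :: "'a::real_normed_vector set \<Rightarrow> 'a \<Rightarrow> 'a set"
  where "bouligand_cone \<Omega> x =
    {d. \<exists>X :: nat \<Rightarrow> 'a. \<exists>\<mu> :: nat \<Rightarrow> real.
          (\<forall>k. X k \<in> \<Omega>) \<and> X \<longlonglongrightarrow> x \<and> (\<forall>k. 0 \<le> \<mu> k) \<and>
          (\<lambda>k. \<mu> k *\<^sub>R (X k - x)) \<longlonglongrightarrow> d}"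

definition clarke_cone :: "'a::real_normed_vector set \<Rightarrow> 'a \<Rightarrow> 'a set"
  where "clarke_cone \<Omega> x =
    {d. \<forall>X :: nat \<Rightarrow> 'a. \<forall>\<mu> :: nat \<Rightarrow> real.
          (\<forall>k. X k \<in> \<Omega>) \<and> X \<longlonglongrightarrow> x \<and> (\<forall>k. 0 \<le> \<mu> k) \<and> \<mu> \<longlonglongrightarrow> 0 \<longrightarrow>
          (\<exists>Y :: nat \<Rightarrow> 'a. Y \<longlonglongrightarrow> d \<and> (\<forall>k. X k + \<mu> k *\<^sub>R Y k \<in> \<Omega>))}"

text \<open>
  In the following definitions \<open>T\<close> is the tangent cone operator, to be instantiated with
  \<^const>\<open>bouligand_cone\<close> or \<^const>\<open>clarke_cone\<close>.
\<close>

definition normal_cone ::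
    "('a::real_inner set \<Rightarrow> 'a \<Rightarrow> 'a set) \<Rightarrow> 'a set \<Rightarrow> 'a \<Rightarrow> 'a set"
  where "normal_cone T \<Omega> x = {d. \<forall>z \<in> T \<Omega> x. d \<bullet> z \<le> 0}"

definition proj_grad ::
    "('a::real_inner set \<Rightarrow> 'a \<Rightarrow> 'a set) \<Rightarrow> 'a set \<Rightarrow> ('a \<Rightarrow> real) \<Rightarrow> 'a \<Rightarrow> 'a set"
  where "proj_grad T \<Omega> f x =
    {d. is_arg_min (\<lambda>d. norm (d + grad f x)) (\<lambda>d. d \<in> T \<Omega> x) d}"

definition alpha_stationary ::
    "real \<Rightarrow> 'a::real_inner set \<Rightarrow> ('a \<Rightarrow> real) \<Rightarrow> 'a \<Rightarrow> bool"
  where "alpha_stationary \<alpha> \<Omega> f x \<longleftrightarrow> x \<in> \<Omega> \<and> x \<in> proj \<Omega> (x - \<alpha> *\<^sub>R grad f x)"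

definition N_stationary ::
    "('a::real_inner set \<Rightarrow> 'a \<Rightarrow> 'a set) \<Rightarrow> 'a set \<Rightarrow> ('a \<Rightarrow> real) \<Rightarrow> 'a \<Rightarrow> bool"
  where "N_stationary T \<Omega> f x \<longleftrightarrow>
    x \<in> \<Omega> \<and> 0 \<in> (\<lambda>v. grad f x + v) ` normal_cone T \<Omega> x"

text \<open>
  As \<^const>\<open>proj_grad\<close> is set-valued, its norm being \<open>0\<close> is read in the strongest sense:
  a minimiser exists and every minimiser has norm \<open>0\<close>.
\<close>

definition T_stationary ::
    "('a::real_inner set \<Rightarrow> 'a \<Rightarrow> 'a set) \<Rightarrow> 'a set \<Rightarrow> ('a \<Rightarrow> real) \<Rightarrow> 'a \<Rightarrow> bool"
  where "T_stationary T \<Omega> f x \<longleftrightarrow>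
    x \<in> \<Omega> \<and> proj_grad T \<Omega> f x \<noteq> {} \<and> (\<forall>d \<in> proj_grad T \<Omega> f x. norm d = 0)"

end

theory Submission
  imports Defs
begin

text \<open>
  A point that is a nearest point of \<open>\<Omega>\<close> to \<open>x + v\<close> has \<open>v\<close> as a proximal normal, and proximal
  normals lie in the polar of the Bouligand cone for an arbitrary set \<open>\<Omega>\<close>; this gives the
  implications from \<open>\<alpha>\<close>-stationarity.  Since the Clarke cone is contained in the Bouligand cone,
  both parts are covered.  When the tangent cone is closed and convex, \<open>0\<close> is the projection of
  \<open>- \<nabla>r(x)\<close> onto it iff \<open>- \<nabla>r(x)\<close> lies in the polar cone, which is the claimed equivalence.
  Convexity is where sparsity enters: the Clarke cone (always, as \<open>s < N\<close>) and the
  Bouligand cone (if \<open>\<parallel>x\<parallel>\<^sub>0 = s\<close>) both equal the subspace of vectors supported in the support of \<open>x\<close>.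
\<close>

section \<open>Stationarity and tangent cones for general sets\<close>

lemma N_stationary_iff:
  "N_stationary T \<Omega> f x \<longleftrightarrow> x \<in> \<Omega> \<and> - grad f x \<in> normal_cone T \<Omega> x"
  unfolding N_stationary_def image_iff by (metis add.right_inverse minus_unique)

lemma clarke_coneE:
  assumes "d \<in> clarke_cone \<Omega> x" and "X \<longlonglongrightarrow> x" and "\<And>k. X k \<in> \<Omega>"
    and "\<mu> \<longlonglongrightarrow> 0" and "\<And>k. 0 < \<mu> k"
  obtains Y where "Y \<longlonglongrightarrow> d" and "\<And>k. X k + \<mu> k *\<^sub>R Y k \<in> \<Omega>"
proof -
  have "(\<forall>k. X k \<in> \<Omega>) \<and> X \<longlonglongrightarrow> x \<and> (\<forall>k. 0 \<le> \<mu> k) \<and> \<mu> \<longlonglongrightarrow> 0"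
    using assms(2-5) by (auto intro: less_imp_le)
  with assms(1) have "\<exists>Y. Y \<longlonglongrightarrow> d \<and> (\<forall>k. X k + \<mu> k *\<^sub>R Y k \<in> \<Omega>)"
    unfolding clarke_cone_def by (elim CollectE allE[of _ X] allE[of _ \<mu>] mp)
  then show thesis
    using that by auto
qed

text \<open>Testing the Clarke condition on the constant sequence \<open>x\<close> with steps
  1/(k+1) gives points of \<open>\<Omega>\<close> converging to \<open>x\<close>; multiplying their
  offsets by k+1 recovers the directions \<open>Y k\<close>, which tend to \<open>d\<close>.\<close>

lemma clarke_cone_subset_bouligand_cone:
  assumes "x \<in> \<Omega>"
  shows "clarke_cone \<Omega> x \<subseteq> bouligand_cone \<Omega> x"
proof
  fix d assume "d \<in> clarke_cone \<Omega> x"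
  define \<mu> :: "nat \<Rightarrow> real" where "\<mu> k = inverse (real (Suc k))" for k
  have \<mu>: "\<mu> \<longlonglongrightarrow> 0" "\<And>k. 0 < \<mu> k"
    unfolding \<mu>_def by (rule LIMSEQ_inverse_real_of_nat) simp
  obtain Y where Y: "Y \<longlonglongrightarrow> d" and in\<Omega>: "\<And>k. x + \<mu> k *\<^sub>R Y k \<in> \<Omega>"
    using clarke_coneE[OF \<open>d \<in> clarke_cone \<Omega> x\<close> tendsto_const assms \<mu>] by blast
  have "(\<lambda>k. x + \<mu> k *\<^sub>R Y k) \<longlonglongrightarrow> x + 0 *\<^sub>R d"
    by (intro tendsto_intros \<mu> Y)
  moreover have "inverse (\<mu> k) *\<^sub>R (x + \<mu> k *\<^sub>R Y k - x) = Y k" for k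
    using \<mu>(2)[of k] by simp
  ultimately show "d \<in> bouligand_cone \<Omega> x"
    unfolding bouligand_cone_def using Y in\<Omega> \<mu>(2)
    by (intro CollectI exI[of _ "\<lambda>k. x + \<mu> k *\<^sub>R Y k"] exI[of _ "\<lambda>k. inverse (\<mu> k)"])
       (auto simp: less_imp_le)
qed

text \<open>Squaring the nearest-point inequality bounds 2 \<open>v \<bullet> (X k - x)\<close> by
  the square of \<open>norm (X k - x)\<close>. After scaling by \<open>\<mu> k\<close> the bound is
  the inner product of a convergent sequence with a null sequence, so it vanishes in the
  limit.\<close>

lemma proximal_normal_in_normal_cone:
  fixes x v :: "'a::real_inner"
  assumes "x \<in> proj \<Omega> (x + v)"
  shows "v \<in> normal_cone bouligand_cone \<Omega> x"
  unfolding normal_cone_def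
proof (intro CollectI ballI)
  fix d assume "d \<in> bouligand_cone \<Omega> x"
  then obtain X \<mu> where X: "\<And>k. X k \<in> \<Omega>" "X \<longlonglongrightarrow> x"
    and \<mu>: "\<And>k. 0 \<le> \<mu> k" and d: "(\<lambda>k. \<mu> k *\<^sub>R (X k - x)) \<longlonglongrightarrow> d"
    unfolding bouligand_cone_def by auto
  let ?D = "\<lambda>k. \<mu> k *\<^sub>R (X k - x)"
  have "2 * (v \<bullet> ?D k) \<le> ?D k \<bullet> (X k - x)" for k
  proof -
    have "norm v \<le> norm (v - (X k - x))"
      using assms X(1)[of k]
      by (auto simp: proj_def is_arg_min_linorder algebra_simps)
    then have "v \<bullet> v \<le> (v - (X k - x)) \<bullet> (v - (X k - x))"
      by (simp add: norm_le)
    then have "2 * (v \<bullet> (X k - x)) \<le> (X k - x) \<bullet> (X k - x)"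
      unfolding inner_diff_left[of v] inner_diff_right[of _ v] inner_commute[of "X k - x" v]
      by linarith
    from mult_left_mono[OF this \<mu>[of k]] show ?thesis
      by (simp only: inner_scaleR_left inner_scaleR_right mult.left_commute)
  qed
  moreover have "(\<lambda>k. 2 * (v \<bullet> ?D k)) \<longlonglongrightarrow> 2 * (v \<bullet> d)"
    by (intro tendsto_intros d)
  moreover have "(\<lambda>k. ?D k \<bullet> (X k - x)) \<longlonglongrightarrow> d \<bullet> (x - x)"
    by (intro tendsto_intros d X)
  ultimately have "2 * (v \<bullet> d) \<le> d \<bullet> (x - x)"
    by (meson LIMSEQ_le)
  then show "v \<bullet> d \<le> 0" by simp
qed

text \<open>The proximal normal here is the negative gradient times \<alpha>; as \<alpha> is
  positive, it can be divided out of the polar inequality.\<close>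

lemma alpha_stationary_imp_N_stationary_bouligand:
  assumes "alpha_stationary \<alpha> \<Omega> f x" and "0 < \<alpha>"
  shows "N_stationary bouligand_cone \<Omega> f x"
  using assms proximal_normal_in_normal_cone[of x \<Omega> "- (\<alpha> *\<^sub>R grad f x)"]
  by (auto simp: alpha_stationary_def N_stationary_iff normal_cone_def zero_le_mult_iff)

lemma N_stationary_bouligand_imp_clarke:
  assumes "N_stationary bouligand_cone \<Omega> f x"
  shows "N_stationary clarke_cone \<Omega> f x"
  using assms clarke_cone_subset_bouligand_cone[of x \<Omega>]
  by (auto simp: N_stationary_iff normal_cone_def)

lemma N_stationary_iff_T_stationary:
  fixes x :: "'a::euclidean_space"
  assumes "convex (T \<Omega> x)" and "closed (T \<Omega> x)" and zero: "0 \<in> T \<Omega> x"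
  shows "N_stationary T \<Omega> f x \<longleftrightarrow> T_stationary T \<Omega> f x"
proof (cases "x \<in> \<Omega>")
  case True
  let ?g = "grad f x"
  have proj_grad_iff: "d \<in> proj_grad T \<Omega> f x \<longleftrightarrow>
      d \<in> T \<Omega> x \<and> (\<forall>z\<in>T \<Omega> x. norm (d + ?g) \<le> norm (z + ?g))" for d
    by (auto simp: proj_grad_def is_arg_min_linorder)
  show ?thesis
  proof
    assume "N_stationary T \<Omega> f x"
    \<comment> \<open>Expanding the square leaves the cross term 2 \<open>z \<bullet> ?g\<close>,
      which the normal cone condition makes nonnegative. This one inequality yields both that 0 is a
      minimiser and that it is the only one.\<close>
    then have ge: "(norm z)\<^sup>2 + (norm ?g)\<^sup>2 \<le> (norm (z + ?g))\<^sup>2" if "z \<in> T \<Omega> x" for z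
      using that
      by (simp add: N_stationary_iff normal_cone_def power2_norm_eq_inner inner_add_left
          inner_add_right inner_commute[of z ?g])
    then have "norm ?g \<le> norm (z + ?g)" if "z \<in> T \<Omega> x" for z
      using that by (smt (verit) norm_ge_zero power2_le_imp_le zero_le_power2)
    with zero have "0 \<in> proj_grad T \<Omega> f x"
      by (simp add: proj_grad_iff)
    moreover have "norm d = 0" if "d \<in> proj_grad T \<Omega> f x" for d
    proof -
      have "d \<in> T \<Omega> x" "norm (d + ?g) \<le> norm ?g"
        using that zero by (auto simp: proj_grad_iff)
      then have "(norm d)\<^sup>2 \<le> 0"
        using ge[of d] power_mono[of "norm (d + ?g)" "norm ?g" 2] norm_ge_zero[of "d + ?g"]
        by linarith
      then show ?thesis by simp
    qed
    ultimately show "T_stationary T \<Omega> f x"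
      using True by (auto simp: T_stationary_def)
  next
    assume "T_stationary T \<Omega> f x"
    then have "0 \<in> proj_grad T \<Omega> f x"
      by (auto simp: T_stationary_def)
    then have "\<forall>z\<in>T \<Omega> x. dist (- ?g) 0 \<le> dist (- ?g) z"
      by (simp add: proj_grad_iff dist_norm norm_minus_commute[of "- ?g"])
    \<comment> \<open>0 is a nearest point of the cone to \<open>- ?g\<close>, so the obtuse-angle
      criterion reads \<open>- ?g \<bullet> z \<le> 0\<close>.\<close>
    from any_closest_point_dot[OF assms(1,2) zero _ this] True
    show "N_stationary T \<Omega> f x"
      by (simp add: N_stationary_iff normal_cone_def)
  qed
qed (simp add: N_stationary_def T_stationary_def)

section \<open>Tangent cones of the nonnegative sparse set\<close>

definition supported_in_support :: "real ^ 'n \<Rightarrow> (real ^ 'n) set"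
  where "supported_in_support x = {d. \<forall>i. x $ i = 0 \<longrightarrow> d $ i = 0}"

lemma subspace_supported_in_support: "subspace (supported_in_support x)"
  by (auto simp: supported_in_support_def subspace_def)

lemma mem_nonneg_sparse:
  "x \<in> nonneg_sparse s \<longleftrightarrow> card {i. x $ i \<noteq> 0} \<le> s \<and> (\<forall>i. 0 \<le> x $ i)"
  by (simp add: nonneg_sparse_def sparse_set_def l0_def less_eq_vec_def)

lemma eventually_pos_on_support:
  fixes x :: "real ^ 'n"
  assumes "X \<longlonglongrightarrow> x" and "0 \<le> x"
  shows "\<forall>\<^sub>F k in sequentially. \<forall>i. x $ i \<noteq> 0 \<longrightarrow> 0 < X k $ i"
proof (rule eventually_all_finite)
  fix i
  have "(\<lambda>k. X k $ i) \<longlonglongrightarrow> x $ i"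
    by (intro tendsto_intros assms)
  then show "\<forall>\<^sub>F k in sequentially. x $ i \<noteq> 0 \<longrightarrow> 0 < X k $ i"
    using order_tendstoD(1)[of _ "x $ i" _ 0] assms(2)
    by (cases "x $ i = 0") (auto simp: less_eq_vec_def less_le)
qed

text \<open>A step along \<open>d\<close> changes only coordinates in the support of
  \<open>x\<close>, and near \<open>x\<close> these are positive before and after the step. Hence
  the support does not grow and no sign is lost.\<close>

lemma supported_in_support_subset_clarke_cone:
  assumes "0 \<le> x"
  shows "supported_in_support x \<subseteq> clarke_cone (nonneg_sparse s) x"
proof
  fix d assume d: "d \<in> supported_in_support x"
  show "d \<in> clarke_cone (nonneg_sparse s) x"
    unfolding clarke_cone_def
  proof (intro CollectI allI impI, elim conjE)
    fix X and \<mu> :: "nat \<Rightarrow> real"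
    assume X: "\<forall>k. X k \<in> nonneg_sparse s" "X \<longlonglongrightarrow> x" and \<mu>: "\<mu> \<longlonglongrightarrow> 0"
    let ?\<Omega> = "nonneg_sparse s :: (real ^ 'a) set"
    have "(\<lambda>k. X k + \<mu> k *\<^sub>R d) \<longlonglongrightarrow> x + 0 *\<^sub>R d"
      by (intro tendsto_intros X \<mu>)
    then have "\<forall>\<^sub>F k in sequentially. \<forall>i. x $ i \<noteq> 0 \<longrightarrow> 0 < (X k + \<mu> k *\<^sub>R d) $ i"
      using assms by (intro eventually_pos_on_support) auto
    with eventually_pos_on_support[OF X(2) assms]
    have ev: "\<forall>\<^sub>F k in sequentially. X k + \<mu> k *\<^sub>R d \<in> ?\<Omega>"
    proof eventually_elim
      case (elim k)
      have off: "(X k + \<mu> k *\<^sub>R d) $ i = X k $ i" if "x $ i = 0" for i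
        using d that by (simp add: supported_in_support_def)
      then have "{i. (X k + \<mu> k *\<^sub>R d) $ i \<noteq> 0} \<subseteq> {i. X k $ i \<noteq> 0}"
        using elim(1) by fastforce
      then have "card {i. (X k + \<mu> k *\<^sub>R d) $ i \<noteq> 0} \<le> card {i. X k $ i \<noteq> 0}"
        by (intro card_mono) auto
      moreover have "0 \<le> (X k + \<mu> k *\<^sub>R d) $ i" for i
        using off[of i] elim(2) X(1) by (cases "x $ i = 0") (auto simp: mem_nonneg_sparse less_imp_le)
      ultimately show ?case
        using X(1) unfolding mem_nonneg_sparse by (meson order_trans)
    qed
    \<comment> \<open>Only finitely many steps can leave the set; there the zero direction keeps the
      point at \<open>X k\<close>.\<close>
    define Y where "Y k = (if X k + \<mu> k *\<^sub>R d \<in> ?\<Omega> then d else 0)" for k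
    have "Y \<longlonglongrightarrow> d"
      by (rule tendsto_eventually, use ev in eventually_elim) (simp add: Y_def)
    moreover have "X k + \<mu> k *\<^sub>R Y k \<in> ?\<Omega>" for k
      using X(1) by (simp add: Y_def)
    ultimately show "\<exists>Y. Y \<longlonglongrightarrow> d \<and> (\<forall>k. X k + \<mu> k *\<^sub>R Y k \<in> ?\<Omega>)"
      by blast
  qed
qed

text \<open>Points of the set close to \<open>x\<close> are nonzero on the whole support of
  \<open>x\<close>, which already has \<open>s\<close> elements, so their support equals it. Their
  offsets from \<open>x\<close> thus lie in a closed subspace.\<close>

lemma bouligand_cone_nonneg_sparse:
  assumes "l0 x = s" and "0 \<le> x"
  shows "bouligand_cone (nonneg_sparse s) x = supported_in_support x"
proof
  have "x \<in> nonneg_sparse s"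
    using assms by (simp add: nonneg_sparse_def sparse_set_def)
  then show "supported_in_support x \<subseteq> bouligand_cone (nonneg_sparse s) x"
    using supported_in_support_subset_clarke_cone[OF assms(2)] clarke_cone_subset_bouligand_cone
    by blast
next
  show "bouligand_cone (nonneg_sparse s) x \<subseteq> supported_in_support x"
  proof
    fix d assume "d \<in> bouligand_cone (nonneg_sparse s) x"
    then obtain X \<mu> where X: "\<And>k. X k \<in> nonneg_sparse s" "X \<longlonglongrightarrow> x"
      and d: "(\<lambda>k. \<mu> k *\<^sub>R (X k - x)) \<longlonglongrightarrow> d"
      unfolding bouligand_cone_def by auto
    have "\<forall>\<^sub>F k in sequentially. X k - x \<in> supported_in_support x"
      using eventually_pos_on_support[OF X(2) assms(2)]
    proof eventually_elim
      case (elim k)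
      have "{i. x $ i \<noteq> 0} = {i. X k $ i \<noteq> 0}"
        using elim X(1)[of k] assms(1)
        by (intro card_seteq) (auto simp: mem_nonneg_sparse l0_def less_le)
      then show ?case
        by (auto simp: supported_in_support_def)
    qed
    then have "\<forall>\<^sub>F k in sequentially. \<mu> k *\<^sub>R (X k - x) \<in> supported_in_support x"
      by eventually_elim (intro subspace_mul subspace_supported_in_support)
    with closed_subspace[OF subspace_supported_in_support] d
    show "d \<in> supported_in_support x"
      by (intro Lim_in_closed_set[of _ _ sequentially]) auto
  qed
qed

lemma clarke_cone_nonneg_sparse:
  fixes x :: "real ^ 'n"
  assumes "l0 x \<le> s" and "s < CARD('n)" and "0 \<le> x"
  shows "clarke_cone (nonneg_sparse s) x = supported_in_support x"
proof
  show "supported_in_support x \<subseteq> clarke_cone (nonneg_sparse s) x"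
    by (rule supported_in_support_subset_clarke_cone[OF assms(3)])
next
  show "clarke_cone (nonneg_sparse s) x \<subseteq> supported_in_support x"
  proof
    fix d assume d: "d \<in> clarke_cone (nonneg_sparse s) x"
    have "d $ i = 0" if i: "x $ i = 0" for i
    proof -
      \<comment> \<open>Approach \<open>x\<close> through points whose support is a fixed set \<open>J\<close> of full size \<open>s\<close> avoiding \<open>i\<close>:
        a step much shorter than their distance to \<open>x\<close> cannot leave \<open>J\<close>.\<close>
      have "card {j. x $ j \<noteq> 0} \<le> s" "s \<le> card (UNIV - {i})"
        using assms(1,2) by (auto simp: l0_def card_Diff_singleton)
      then obtain J where J: "{j. x $ j \<noteq> 0} \<subseteq> J" "i \<notin> J" "card J = s"
        using exists_subset_between[of "{j. x $ j \<noteq> 0}" s "UNIV - {i}"] i by auto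
      define \<mu> :: "nat \<Rightarrow> real" where "\<mu> k = inverse (real (Suc k))" for k
      define u :: "real ^ 'n" where "u = (\<chi> j. if j \<in> J then 1 else 0)"
      have \<mu>: "\<mu> \<longlonglongrightarrow> 0" "\<And>k. 0 < \<mu> k"
        unfolding \<mu>_def by (rule LIMSEQ_inverse_real_of_nat) simp
      have lim: "(\<lambda>k. x + \<mu> k *\<^sub>R u) \<longlonglongrightarrow> x"
        using tendsto_add[OF tendsto_const tendsto_scaleR[OF \<mu>(1) tendsto_const]] by simp
      have lim2: "(\<lambda>k. \<mu> k * \<mu> k) \<longlonglongrightarrow> 0"
        by (intro tendsto_mult_zero \<mu>)
      have mem: "x + \<mu> k *\<^sub>R u \<in> nonneg_sparse s" for k
      proof -
        have "{j. (x + \<mu> k *\<^sub>R u) $ j \<noteq> 0} \<subseteq> J"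
          using J(1) by (auto simp: u_def)
        then have "card {j. (x + \<mu> k *\<^sub>R u) $ j \<noteq> 0} \<le> s"
          unfolding J(3)[symmetric] by (intro card_mono) auto
        then show ?thesis
          using assms(3) \<mu>(2)[of k] by (auto simp: mem_nonneg_sparse u_def less_eq_vec_def)
      qed
      \<comment> \<open>The base point is at distance of order \<open>\<mu> k\<close> from
        \<open>x\<close>, while the step has length parameter \<open>\<mu> k * \<mu> k\<close>.
        Factoring out \<open>\<mu> k\<close> leaves \<open>u + \<mu> k *\<^sub>R Y k\<close>, which
        tends to \<open>u\<close>.\<close>
      obtain Y where Y: "Y \<longlonglongrightarrow> d"
        and in\<Omega>: "\<And>k. x + \<mu> k *\<^sub>R u + (\<mu> k * \<mu> k) *\<^sub>R Y k \<in> nonneg_sparse s"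
        using clarke_coneE[OF d lim mem lim2] \<mu>(2) by auto
      have "(\<lambda>k. u + \<mu> k *\<^sub>R Y k) \<longlonglongrightarrow> u + 0 *\<^sub>R d"
        by (intro tendsto_intros \<mu> Y)
      then have "\<forall>\<^sub>F k in sequentially. \<forall>j. u $ j \<noteq> 0 \<longrightarrow> 0 < (u + \<mu> k *\<^sub>R Y k) $ j"
        by (intro eventually_pos_on_support) (auto simp: u_def less_eq_vec_def)
      then have "\<forall>\<^sub>F k in sequentially. Y k $ i = 0"
      proof eventually_elim
        case (elim k)
        let ?z = "x + \<mu> k *\<^sub>R u + (\<mu> k * \<mu> k) *\<^sub>R Y k"
        have "0 < ?z $ j" if "j \<in> J" for j
        proof -
          have "?z $ j = x $ j + \<mu> k * (u + \<mu> k *\<^sub>R Y k) $ j"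
            by (simp add: algebra_simps)
          moreover have "0 < (u + \<mu> k *\<^sub>R Y k) $ j"
            using elim[rule_format, of j] that by (simp add: u_def)
          ultimately show ?thesis
            using assms(3) \<mu>(2)[of k] by (simp only: less_eq_vec_def zero_index add_nonneg_pos mult_pos_pos)
        qed
        \<comment> \<open>The support of \<open>?z\<close> contains \<open>J\<close> and has at most
          \<open>s\<close> elements, so it has no room for \<open>i\<close>.\<close>
        then have "J = {j. ?z $ j \<noteq> 0}"
          using in\<Omega>[of k] J(3) by (intro card_seteq) (force simp: mem_nonneg_sparse)+
        with J(2) have "?z $ i = 0" by blast
        then show ?case
          using i J(2) \<mu>(2)[of k] by (simp add: u_def)
      qed
      then have "(\<lambda>k. Y k $ i) \<longlonglongrightarrow> 0"
        by (rule tendsto_eventually)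
      moreover have "(\<lambda>k. Y k $ i) \<longlonglongrightarrow> d $ i"
        by (intro tendsto_intros Y)
      ultimately show ?thesis
        by (metis LIMSEQ_unique)
    qed
    then show "d \<in> supported_in_support x"
      by (simp add: supported_in_support_def)
  qed
qed

theorem theorem3p3:
  fixes A :: "real ^ 'n ^ 'm" and b :: "real ^ 'm" and s :: nat and \<alpha> :: real
  assumes "0 < s" and "s < CARD('m)" and "CARD('m) < CARD('n)" and "0 < \<alpha>"
  shows "(\<forall>x :: real ^ 'n. l0 x = s \<and> 0 \<le> x \<longrightarrow>
           (alpha_stationary \<alpha> (nonneg_sparse s) (residual A b) x \<longrightarrow>
              N_stationary bouligand_cone (nonneg_sparse s) (residual A b) x) \<and>
           (N_stationary bouligand_cone (nonneg_sparse s) (residual A b) x \<longleftrightarrow>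
              T_stationary bouligand_cone (nonneg_sparse s) (residual A b) x)) \<and>
         (\<forall>x :: real ^ 'n. l0 x \<le> s \<and> 0 \<le> x \<longrightarrow>
           (alpha_stationary \<alpha> (nonneg_sparse s) (residual A b) x \<longrightarrow>
              N_stationary clarke_cone (nonneg_sparse s) (residual A b) x) \<and>
           (N_stationary clarke_cone (nonneg_sparse s) (residual A b) x \<longleftrightarrow>
              T_stationary clarke_cone (nonneg_sparse s) (residual A b) x))"
proof (intro conjI allI impI; elim conjE)
  fix x :: "real ^ 'n"
  assume "l0 x = s" and "0 \<le> x"
  then show "N_stationary bouligand_cone (nonneg_sparse s) (residual A b) x \<longleftrightarrow>
      T_stationary bouligand_cone (nonneg_sparse s) (residual A b) x"
    using subspace_supported_in_support[of x]
    by (intro N_stationary_iff_T_stationary)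
       (simp_all add: bouligand_cone_nonneg_sparse subspace_imp_convex closed_subspace subspace_0)
next
  fix x :: "real ^ 'n"
  assume "l0 x \<le> s" and "0 \<le> x"
  then show "N_stationary clarke_cone (nonneg_sparse s) (residual A b) x \<longleftrightarrow>
      T_stationary clarke_cone (nonneg_sparse s) (residual A b) x"
    using subspace_supported_in_support[of x] assms(2,3)
    by (intro N_stationary_iff_T_stationary)
       (simp_all add: clarke_cone_nonneg_sparse subspace_imp_convex closed_subspace subspace_0)
\<comment> \<open>Both remaining implications start from Bouligand normality; the second passes on
  to the Clarke cone.\<close>
qed (use \<open>0 < \<alpha>\<close> in \<open>simp_all add: N_stationary_bouligand_imp_clarke
    alpha_stationary_imp_N_stationary_bouligand\<close>)

end
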